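(* Let $n\ge2$ and let $Q=\{z\in\mathbb{C}^{n+1} : \sum_{j=0}^n z_j^2=1\}$ be the complex sphere, equipped with the Stenzel form $\omega_{St}$ and the holomorphic $(n,0)$-form $\Omega$ determined by $$\Omega\wedge d(z_0^2+z_1^2+\dots+z_n^2-1)=dz_0\wedge\dots\wedge dz_n .$$ Let $p\in\mathbb{S}^n$, let $A_p\in SO(n+1)$ satisfy $A_p(\{x_0=0\})=p^\perp$, let $I\subset\mathbb{R}$ be an interval, and let $\gamma:I\to\mathbb{C}^*=\mathbb{C}\setminus\{0\}$ be a smooth regular curve which avoids the points $\pm1$. Then the immersion $$X_{p,\gamma}: I\times\mathbb{S}^{n-1}\to Q,\qquad X_{p,\gamma}(s,x)=\gamma(s)\,p+\sqrt{1-\gamma(s)^2}\,A_p x$$ is special Lagrangian if and only if $$\mathrm{Im}\left(\dot\gamma\,\bigl(\sqrt{1-\gamma^2}\bigr)^{n-2}\right)=0\quad\text{on } I.$$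
   Context: Coordinates on $\mathbb{R}^{n+1}\subset\mathbb{C}^{n+1}$ are indexed $0,\dots,n$. $\mathbb{S}^n$ is the unit sphere of $\mathbb{R}^{n+1}$ and $\mathbb{S}^{n-1}=\mathbb{S}^n\cap\{x_0=0\}$. A smooth choice of the square root $\sqrt{1-\gamma^2}$ is made along $\gamma$; neither the image of $X_{p,\gamma}$ nor the condition $\mathrm{Im}(\cdot)=0$ depends on it, and the image does not depend on the choice of $A_p$ either. With $r^2=\sum_{j=0}^n z_j\bar z_j$, one has $\omega_{St}=i\,\partial\bar\partial\,u(r^2)$ on $Q$, where $u$ is a smooth real function such that $\omega_{St}$ is the symplectic (Kähler) form of a Ricci-flat Kähler metric on $Q$ (the Stenzel metric). The relation defining $\Omega$ is understood along $Q$. An immersion $X:L\to Q$ of a manifold of real dimension $n$ is called special Lagrangian if $X^*\omega_{St}=0$ and $X^*(\mathrm{Im}\,\Omega)=0$. "Regular" means that $\dot\gamma$, the derivative of $\gamma$ in $s$, never vanishes. *)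

theory Defs
  imports "HOL-Analysis.Analysis"
begin

text \<open>
  The index type \<open>'n option\<close> stands for \<open>{0,...,n}\<close> with \<open>n = CARD('n)\<close>: \<open>None\<close> is the index 0 and
  \<open>Some i\<close> runs through \<open>1,...,n\<close>. Multilinear forms take a family of vectors indexed by their
  slots, so that nothing below depends on an enumeration of \<open>'n\<close>.
\<close>

type_synonym 'n cvec = "complex ^ ('n option)"
type_synonym 'n rvec = "real ^ ('n option)"

subsection \<open>Smooth maps and immersions\<close>

text \<open>
  For \<open>S\<close> an interval with interior points, an open set, or an embedded submanifold (possibly with
  boundary), \<open>smooth_on S f\<close> is the usual \<open>C\<^sup>\<infinity>\<close> notion on \<open>S\<close>: a derivative within \<open>S\<close> is determined
  exactly on the vectors tangent to \<open>S\<close>.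
\<close>

primrec Ck_on :: "nat \<Rightarrow> 'a::euclidean_space set \<Rightarrow> ('a \<Rightarrow> 'b::real_normed_vector) \<Rightarrow> bool" where
  "Ck_on 0 S f \<longleftrightarrow> continuous_on S f"
| "Ck_on (Suc k) S f \<longleftrightarrow>
     (\<exists>D. (\<forall>x\<in>S. (f has_derivative D x) (at x within S)) \<and> (\<forall>v. Ck_on k S (\<lambda>x. D x v)))"

definition smooth_on :: "'a::euclidean_space set \<Rightarrow> ('a \<Rightarrow> 'b::real_normed_vector) \<Rightarrow> bool" where
  "smooth_on S f \<longleftrightarrow> (\<forall>k. Ck_on k S f)"

text \<open>Here \<open>T q\<close> is the tangent space at \<open>q\<close> of the embedded manifold \<open>L\<close>.\<close>

definition immersion_on ::
  "'a::euclidean_space set \<Rightarrow> ('a \<Rightarrow> 'a set) \<Rightarrow> ('a \<Rightarrow> 'b::real_normed_vector) \<Rightarrow> bool" where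
  "immersion_on L T X \<longleftrightarrow> smooth_on L X \<and>
     (\<forall>q\<in>L. \<exists>D. (X has_derivative D) (at q within L) \<and> inj_on D (T q))"

subsection \<open>The complex sphere\<close>

definition quad :: "'n::finite cvec \<Rightarrow> complex" where
  "quad z = (\<Sum>j\<in>UNIV. (z $ j)\<^sup>2)"

definition complex_sphere :: "'n::finite cvec set" where
  "complex_sphere = {z. quad z = 1}"

definition tangent_Q :: "'n::finite cvec \<Rightarrow> 'n cvec set" where
  "tangent_Q z = {v. frechet_derivative quad (at z) v = 0}"

definition holo_on :: "(complex ^ 'n::finite) set \<Rightarrow> (complex ^ 'n \<Rightarrow> complex) \<Rightarrow> bool" where
  "holo_on U f \<longleftrightarrow>
     (\<forall>\<xi>\<in>U. \<exists>D. (f has_derivative D) (at \<xi>) \<and> (\<forall>c v. D (c *s v) = c * D v))"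

text \<open>Local holomorphic parametrizations of the complex sphere; their images cover it.\<close>

definition local_param :: "(complex ^ 'n::finite) set \<Rightarrow> (complex ^ 'n \<Rightarrow> 'n cvec) \<Rightarrow> bool" where
  "local_param U \<phi> \<longleftrightarrow> open U \<and> \<phi> ` U \<subseteq> complex_sphere \<and> (\<forall>j. holo_on U (\<lambda>\<xi>. \<phi> \<xi> $ j)) \<and>
     inj_on \<phi> U \<and> (\<forall>\<xi>\<in>U. inj (frechet_derivative \<phi> (at \<xi>)))"

subsection \<open>Ricci curvature of a metric on an open subset of a Euclidean space\<close>

text \<open>
  A metric assigns to each point \<open>\<xi>\<close> an inner product \<open>G \<xi>\<close>. \<open>christoffel G \<xi> a b\<close> is the Levi-Civita
  derivative \<open>\<nabla>\<^sub>a b\<close> of the constant vector field \<open>b\<close>, given by the Koszul formula, and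
  \<open>riemann G \<xi> a b c = \<nabla>\<^sub>a \<nabla>\<^sub>b c - \<nabla>\<^sub>b \<nabla>\<^sub>a c\<close> for constant fields.
\<close>

definition christoffel :: "('a::euclidean_space \<Rightarrow> 'a \<Rightarrow> 'a \<Rightarrow> real) \<Rightarrow> 'a \<Rightarrow> 'a \<Rightarrow> 'a \<Rightarrow> 'a" where
  "christoffel G \<xi> a b = (THE c. \<forall>d. G \<xi> c d =
     (frechet_derivative (\<lambda>\<eta>. G \<eta> b d) (at \<xi>) a
      + frechet_derivative (\<lambda>\<eta>. G \<eta> a d) (at \<xi>) b
      - frechet_derivative (\<lambda>\<eta>. G \<eta> a b) (at \<xi>) d) / 2)"

definition riemann :: "('a::euclidean_space \<Rightarrow> 'a \<Rightarrow> 'a \<Rightarrow> real) \<Rightarrow> 'a \<Rightarrow> 'a \<Rightarrow> 'a \<Rightarrow> 'a \<Rightarrow> 'a" where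
  "riemann G \<xi> a b c =
     frechet_derivative (\<lambda>\<eta>. christoffel G \<eta> b c) (at \<xi>) a
     + christoffel G \<xi> a (christoffel G \<xi> b c)
     - frechet_derivative (\<lambda>\<eta>. christoffel G \<eta> a c) (at \<xi>) b
     - christoffel G \<xi> b (christoffel G \<xi> a c)"

definition ricci :: "('a::euclidean_space \<Rightarrow> 'a \<Rightarrow> 'a \<Rightarrow> real) \<Rightarrow> 'a \<Rightarrow> 'a \<Rightarrow> 'a \<Rightarrow> real" where
  "ricci G \<xi> b c = (\<Sum>a\<in>Basis. riemann G \<xi> a b c \<bullet> a)"

subsection \<open>Stenzel forms\<close>

definition wirtinger :: "'m::finite \<Rightarrow> (complex ^ 'm \<Rightarrow> complex) \<Rightarrow> complex ^ 'm \<Rightarrow> complex" where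
  "wirtinger j F z =
     (frechet_derivative F (at z) (axis j 1) - \<i> * frechet_derivative F (at z) (axis j \<i>)) / 2"

definition wirtinger_bar :: "'m::finite \<Rightarrow> (complex ^ 'm \<Rightarrow> complex) \<Rightarrow> complex ^ 'm \<Rightarrow> complex" where
  "wirtinger_bar j F z =
     (frechet_derivative F (at z) (axis j 1) + \<i> * frechet_derivative F (at z) (axis j \<i>)) / 2"

text \<open>
  The value on \<open>(v, w)\<close> of the 2-form \<open>i \<partial>\<partial>bar F\<close> at \<open>z\<close>, with
  \<open>(\<alpha> \<and> \<beta>)(v, w) = \<alpha> v * \<beta> w - \<alpha> w * \<beta> v\<close>.
\<close>

definition i_ddbar ::
  "(complex ^ 'm::finite \<Rightarrow> complex) \<Rightarrow> complex ^ 'm \<Rightarrow> complex ^ 'm \<Rightarrow> complex ^ 'm \<Rightarrow> complex" where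
  "i_ddbar F z v w = \<i> * (\<Sum>j\<in>UNIV. \<Sum>k\<in>UNIV.
     wirtinger j (wirtinger_bar k F) z * (v $ j * cnj (w $ k) - w $ j * cnj (v $ k)))"

definition rsq :: "'n::finite cvec \<Rightarrow> real" where
  "rsq z = Re (\<Sum>j\<in>UNIV. z $ j * cnj (z $ j))"

text \<open>
  On the complex sphere \<open>rsq\<close> takes the values \<open>{1..}\<close>. As the sphere is a complex submanifold,
  \<open>i \<partial>\<partial>bar\<close> of the restriction of a function is the restriction to tangent vectors of the ambient
  \<open>i \<partial>\<partial>bar\<close>. The associated metric is \<open>g(v, w) = \<omega>(v, i w)\<close>; it is automatically Kaehler when
  positive definite, since \<open>i \<partial>\<partial>bar\<close> of a function is closed of type (1,1).
\<close>

definition stenzel_form :: "('n::finite cvec \<Rightarrow> 'n cvec \<Rightarrow> 'n cvec \<Rightarrow> real) \<Rightarrow> bool" where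
  "stenzel_form \<omega> \<longleftrightarrow>
     (\<exists>(u :: real \<Rightarrow> real) W. open W \<and> {1..} \<subseteq> W \<and> smooth_on W u \<and>
        (\<forall>z\<in>complex_sphere. \<forall>v\<in>tangent_Q z. \<forall>w\<in>tangent_Q z.
           complex_of_real (\<omega> z v w) = i_ddbar (\<lambda>y. complex_of_real (u (rsq y))) z v w)) \<and>
     (\<forall>z\<in>complex_sphere. \<forall>v\<in>tangent_Q z. v \<noteq> 0 \<longrightarrow> \<omega> z v (\<i> *s v) > 0) \<and>
     (\<forall>U \<phi>. local_param U \<phi> \<longrightarrow> (\<forall>\<xi>\<in>U. \<forall>a b.
        ricci (\<lambda>\<eta> c d. \<omega> (\<phi> \<eta>) (frechet_derivative \<phi> (at \<eta>) c)
                          (\<i> *s frechet_derivative \<phi> (at \<eta>) d)) \<xi> a b = 0))"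

subsection \<open>The holomorphic volume form\<close>

definition alternating_form :: "(('n::finite \<Rightarrow> complex ^ 'm::finite) \<Rightarrow> complex) \<Rightarrow> bool" where
  "alternating_form \<alpha> \<longleftrightarrow>
     (\<forall>v i c x y. \<alpha> (v(i := c *s x + y)) = c * \<alpha> (v(i := x)) + \<alpha> (v(i := y))) \<and>
     (\<forall>v i j. i \<noteq> j \<and> v i = v j \<longrightarrow> \<alpha> v = 0)"

text \<open>
  \<open>\<alpha> \<and> \<beta>\<close> for an n-form \<open>\<alpha>\<close> and a 1-form \<open>\<beta>\<close>, evaluated on vectors \<open>v\<^sub>0, ..., v\<^sub>n\<close>. The formula
  antisymmetrizes \<open>\<beta> \<and> \<alpha>\<close>, whose first slot is \<open>None\<close>, whence the sign \<open>(-1)\<^sup>n\<close>.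
\<close>

definition wedge1 ::
  "(('n::finite \<Rightarrow> 'v) \<Rightarrow> complex) \<Rightarrow> ('v \<Rightarrow> complex) \<Rightarrow> ('n option \<Rightarrow> 'v) \<Rightarrow> complex" where
  "wedge1 \<alpha> \<beta> v = (-1) ^ CARD('n) / fact CARD('n) *
     (\<Sum>\<sigma> | \<sigma> permutes (UNIV :: 'n option set).
        of_int (sign \<sigma>) * \<beta> (v (\<sigma> None)) * \<alpha> (\<lambda>i. v (\<sigma> (Some i))))"

text \<open>\<open>dz\<^sub>0 \<and> ... \<and> dz\<^sub>n\<close>\<close>

definition dz_volume :: "('n::finite option \<Rightarrow> 'n cvec) \<Rightarrow> complex" where
  "dz_volume v = det (\<chi> i j. v j $ i)"

text \<open>
  \<open>\<Omega> z\<close> is an n-form on the ambient space representing an n-form on the tangent space of the complex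
  sphere at \<open>z\<close>; the wedge relation determines its restriction to tangent vectors, and only that
  restriction is required to be holomorphic.
\<close>

definition holomorphic_volume_form ::
  "('n::finite cvec \<Rightarrow> ('n \<Rightarrow> 'n cvec) \<Rightarrow> complex) \<Rightarrow> bool" where
  "holomorphic_volume_form \<Omega> \<longleftrightarrow>
     (\<forall>z\<in>complex_sphere. alternating_form (\<Omega> z)) \<and>
     (\<forall>U \<phi>. local_param U \<phi> \<longrightarrow>
        holo_on U (\<lambda>\<xi>. \<Omega> (\<phi> \<xi>) (\<lambda>i. frechet_derivative \<phi> (at \<xi>) (axis i 1)))) \<and>
     (\<forall>z\<in>complex_sphere. \<forall>v.
        wedge1 (\<Omega> z) (frechet_derivative (\<lambda>y. quad y - 1) (at z)) v = dz_volume v)"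

subsection \<open>Special Lagrangian immersions\<close>

definition special_lagrangian ::
  "('n::finite cvec \<Rightarrow> 'n cvec \<Rightarrow> 'n cvec \<Rightarrow> real) \<Rightarrow> ('n cvec \<Rightarrow> ('n \<Rightarrow> 'n cvec) \<Rightarrow> complex) \<Rightarrow>
   'a::euclidean_space set \<Rightarrow> ('a \<Rightarrow> 'a set) \<Rightarrow> ('a \<Rightarrow> 'n cvec) \<Rightarrow> bool" where
  "special_lagrangian \<omega> \<Omega> L T X \<longleftrightarrow>
     X ` L \<subseteq> complex_sphere \<and> immersion_on L T X \<and>
     (\<forall>q\<in>L. \<forall>D. (X has_derivative D) (at q within L) \<longrightarrow>
        (\<forall>v\<in>T q. \<forall>w\<in>T q. \<omega> (X q) (D v) (D w) = 0) \<and>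
        (\<forall>v. (\<forall>i. v i \<in> T q) \<longrightarrow> Im (\<Omega> (X q) (\<lambda>i. D (v i))) = 0))"

subsection \<open>The immersions \<open>X\<^sub>p\<^sub>,\<^sub>\<gamma>\<close>\<close>

definition equator :: "'n::finite rvec set" where
  "equator = sphere 0 1 \<inter> {x. x $ None = 0}"

definition tangent_prod :: "real \<times> 'n::finite rvec \<Rightarrow> (real \<times> 'n rvec) set" where
  "tangent_prod q = UNIV \<times> {v. v $ None = 0 \<and> snd q \<bullet> v = 0}"

text \<open>\<open>\<rho>\<close> is the chosen square root of \<open>1 - \<gamma>\<^sup>2\<close> along \<open>\<gamma>\<close>.\<close>

definition X_map ::
  "'n::finite rvec \<Rightarrow> real ^ ('n option) ^ ('n option) \<Rightarrow> (real \<Rightarrow> complex) \<Rightarrow> (real \<Rightarrow> complex) \<Rightarrow>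
   real \<times> 'n rvec \<Rightarrow> 'n cvec" where
  "X_map p A \<gamma> \<rho> = (\<lambda>(s, x). \<chi> j. \<gamma> s * of_real (p $ j) + \<rho> s * of_real ((A *v x) $ j))"

end

theory Submission
  imports Defs
begin

text \<open>
  Write \<open>q = (s, x)\<close> for a point of \<open>I \<times> equator\<close> and \<open>z = \<gamma> p + \<rho> A x\<close> for its image. The differential sends
  \<open>(a, \<eta>)\<close> to \<open>a (\<gamma>' p + \<rho>' A x) + \<rho> A \<eta>\<close>, and \<open>p\<close>, \<open>A x\<close>, \<open>A \<eta>\<close> are real and mutually orthogonal. With
  \<open>\<gamma>\<^sup>2 + \<rho>\<^sup>2 = 1\<close> and its derivative \<open>\<gamma> \<gamma>' + \<rho> \<rho>' = 0\<close>, orthogonality shows that \<open>X\<^sub>p\<^sub>,\<^sub>\<gamma>\<close> maps into the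
  quadric; it is an immersion because \<open>\<gamma>'\<close> and \<open>\<rho>\<close> do not vanish.

  The image is always Lagrangian. The form \<open>i \<partial>\<partial>bar u(r\<^sup>2)\<close> only sees the imaginary parts of the Hermitian
  product of two tangent vectors and of the product of their values under \<open>\<partial> r\<^sup>2\<close>
  (\<open>stenzel_form_eq_0\<close>). By orthogonality the directions \<open>A \<eta>\<close> do not mix with the direction of \<open>s\<close> in
  either product, and within each kind the products are real multiples of a squared modulus.

  What remains is the phase of \<open>\<Omega>\<close>. Contracting the wedge relation with the radial vector gives
  \<open>\<Omega>(e\<^sub>1, ..., e\<^sub>n) = (-1)\<^sup>n/2 det(z, e\<^sub>1, ..., e\<^sub>n)\<close> on tangent vectors
  (\<open>holomorphic_volume_form_tangent\<close>), and for the images \<open>e\<^sub>k\<close> of tangent vectors \<open>(a\<^sub>k, \<eta>\<^sub>k)\<close> this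
  determinant is \<open>\<gamma>' \<rho>\<^sup>n\<^sup>-\<^sup>2\<close> times the real determinant of \<open>x\<close> and the \<open>a\<^sub>k e + \<eta>\<^sub>k\<close>, where \<open>A e = p\<close>
  (\<open>det_frame\<close>). The real determinant is nonzero for a suitable choice of tangent vectors
  (\<open>exists_tangent_frame\<close>), so \<open>Im \<Omega>\<close> vanishes on the image exactly when \<open>Im (\<gamma>' \<rho>\<^sup>n\<^sup>-\<^sup>2) = 0\<close>.
  Since derivatives within \<open>I \<times> equator\<close> are not unique off the tangent spaces, these computations with
  one differential are transferred to all of them by \<open>tangent_prod_derivative_unique\<close>.
\<close>

section \<open>Calculus with maps of class \<open>C\<^sup>k\<close>\<close>

lemma has_derivative_vec:
  fixes f :: "'a::real_normed_vector \<Rightarrow> ('b::euclidean_space) ^ 'm::finite"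
  assumes "\<And>j. ((\<lambda>x. f x $ j) has_derivative (\<lambda>h. f' h $ j)) (at a within S)"
  shows "(f has_derivative f') (at a within S)"
proof (rule iffD2[OF has_derivative_componentwise_within], rule ballI)
  fix i :: "'b ^ 'm" assume "i \<in> Basis"
  then obtain j b where i: "i = axis j b" "b \<in> Basis" by (auto simp: Basis_vec_def)
  show "((\<lambda>x. f x \<bullet> i) has_derivative (\<lambda>x. f' x \<bullet> i)) (at a within S)"
    unfolding i inner_axis by (intro has_derivative_inner_left assms)
qed

text \<open>The induction for products needs one factor undifferentiated, hence at one order less than
  assumed.\<close>

lemma Ck_on_SucD: "Ck_on (Suc k) S f \<Longrightarrow> Ck_on k S f"
proof (induction k arbitrary: f)
  case 0
  then show ?case by (auto intro: has_derivative_continuous_on)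
next
  case (Suc k)
  then obtain D where "\<forall>x\<in>S. (f has_derivative D x) (at x within S)"
    "\<forall>v. Ck_on (Suc k) S (\<lambda>x. D x v)" by (metis Ck_on.simps(2))
  with Suc.IH show ?case by (metis Ck_on.simps(2))
qed

lemma Ck_on_const: "Ck_on k S (\<lambda>_. c)"
proof (induction k arbitrary: c)
  case (Suc k)
  show ?case unfolding Ck_on.simps
    by (intro exI[of _ "\<lambda>_ _. 0"]) (simp add: Suc)
qed simp

lemma Ck_on_bounded_linear: "bounded_linear f \<Longrightarrow> Ck_on k S f"
  by (cases k) (auto intro!: exI[of _ "\<lambda>_. f"] Ck_on_const bounded_linear_imp_has_derivative
      linear_continuous_on)

lemma Ck_on_add: "Ck_on k S f \<Longrightarrow> Ck_on k S g \<Longrightarrow> Ck_on k S (\<lambda>x. f x + g x)"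
proof (induction k arbitrary: f g)
  case 0
  then show ?case by (auto intro: continuous_intros)
next
  case (Suc k)
  from Suc.prems obtain D E where "\<forall>x\<in>S. (f has_derivative D x) (at x within S)"
    "\<forall>v. Ck_on k S (\<lambda>x. D x v)" "\<forall>x\<in>S. (g has_derivative E x) (at x within S)"
    "\<forall>v. Ck_on k S (\<lambda>x. E x v)" by auto
  then show ?case unfolding Ck_on.simps
    by (intro exI[of _ "\<lambda>x v. D x v + E x v"]) (auto intro: has_derivative_add Suc.IH)
qed

lemma Ck_on_mult:
  fixes f g :: "'a::euclidean_space \<Rightarrow> 'b::real_normed_algebra"
  shows "Ck_on k S f \<Longrightarrow> Ck_on k S g \<Longrightarrow> Ck_on k S (\<lambda>x. f x * g x)"
proof (induction k arbitrary: f g)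
  case 0
  then show ?case by (auto intro: continuous_intros)
next
  case (Suc k)
  from Suc.prems obtain D E where DE: "\<forall>x\<in>S. (f has_derivative D x) (at x within S)"
    "\<forall>v. Ck_on k S (\<lambda>x. D x v)" "\<forall>x\<in>S. (g has_derivative E x) (at x within S)"
    "\<forall>v. Ck_on k S (\<lambda>x. E x v)" by auto
  with Suc.prems show ?case unfolding Ck_on.simps(2)[of _ _ "\<lambda>x. f x * g x"]
    by (intro exI[of _ "\<lambda>x v. f x * E x v + D x v * g x"])
      (auto intro!: has_derivative_mult Ck_on_add Suc.IH Ck_on_SucD[of k S f] Ck_on_SucD[of k S g]
        simp del: Ck_on.simps)
qed

lemma Ck_on_fst: "Ck_on k I f \<Longrightarrow> Ck_on k (I \<times> E) (\<lambda>q. f (fst q))"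
proof (induction k arbitrary: f)
  case 0
  have "continuous_on (I \<times> E) (f \<circ> fst)"
    using 0 by (intro continuous_on_compose)
      (auto intro: continuous_on_fst continuous_on_id elim!: continuous_on_subset)
  then show ?case by (simp add: o_def)
next
  case (Suc k)
  then obtain D where D: "\<forall>x\<in>I. (f has_derivative D x) (at x within I)"
    "\<forall>v. Ck_on k I (\<lambda>x. D x v)" by auto
  have "((\<lambda>q. f (fst q)) has_derivative (\<lambda>h. D (fst q) (fst h))) (at q within I \<times> E)"
    if "q \<in> I \<times> E" for q
  proof -
    have "(f has_derivative D (fst q)) (at (fst q) within fst ` (I \<times> E))"
      using D that by (auto elim!: has_derivative_subset)
    moreover have "(fst has_derivative fst) (at q within I \<times> E)"
      by (intro bounded_linear_imp_has_derivative bounded_linear_fst)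
    ultimately show ?thesis
      by (metis has_derivative_in_compose)
  qed
  with D Suc.IH show ?case
    unfolding Ck_on.simps by (intro exI[of _ "\<lambda>q h. D (fst q) (fst h)"]) auto
qed

lemma Ck_on_vec:
  fixes f :: "'a::euclidean_space \<Rightarrow> ('b::euclidean_space) ^ 'm::finite"
  shows "(\<And>j. Ck_on k S (\<lambda>x. f x $ j)) \<Longrightarrow> Ck_on k S f"
proof (induction k arbitrary: f)
  case 0
  then have "continuous_on S (\<lambda>x. \<chi> j. f x $ j)" by (intro continuous_on_vec_lambda) auto
  then show ?case by simp
next
  case (Suc k)
  then have "\<forall>j. \<exists>D. (\<forall>x\<in>S. ((\<lambda>x. f x $ j) has_derivative D x) (at x within S)) \<and>
    (\<forall>v. Ck_on k S (\<lambda>x. D x v))" by simp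
  then obtain D where D: "\<And>j x. x \<in> S \<Longrightarrow> ((\<lambda>x. f x $ j) has_derivative D j x) (at x within S)"
    "\<And>j v. Ck_on k S (\<lambda>x. D j x v)" by metis
  show ?case unfolding Ck_on.simps
    by (intro exI[of _ "\<lambda>x v. \<chi> j. D j x v"])
      (auto intro!: has_derivative_vec Suc.IH simp: D)
qed

text \<open>A derivative within a set need not be unique, but it is determined on the velocities of
  curves in the set.\<close>

lemma has_derivative_unique_on_velocity:
  assumes D: "(f has_derivative D) (at (c t) within S)"
    and E: "(f has_derivative E) (at (c t) within S)"
    and c: "(c has_vector_derivative w) (at t within J)" "c ` J \<subseteq> S"
    and J: "at t within J \<noteq> bot"
  shows "D w = E w"
  using vector_derivative_unique_within[OF J
      vector_derivative_diff_chain_within[OF c(1) has_derivative_subset[OF D c(2)]]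
      vector_derivative_diff_chain_within[OF c(1) has_derivative_subset[OF E c(2)]]] .

section \<open>Wedge products and determinants\<close>

lemma alternating_form_swap:
  assumes "alternating_form \<alpha>" "i \<noteq> j"
  shows "\<alpha> (v \<circ> Transposition.transpose i j) = - \<alpha> v"
proof -
  have lin: "\<alpha> (v(i := x + y)) = \<alpha> (v(i := x)) + \<alpha> (v(i := y))" for v i x y
    using assms(1) unfolding alternating_form_def by (metis lambda_one vector_smult_lid mult_1)
  have zero: "\<alpha> (v(i := x, j := x)) = 0" for x
    using assms unfolding alternating_form_def by (metis fun_upd_same fun_upd_other)
  let ?s = "\<lambda>x y. \<alpha> (v(i := x, j := y))"
  have "?s (x + y) z = ?s x z + ?s y z" for x y z
    using lin[of "v(j := z)" i] assms(2) by (metis fun_upd_twist)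
  moreover have "?s z (x + y) = ?s z x + ?s z y" for x y z
    using lin[of "v(i := z)" j] by simp
  ultimately have "\<alpha> (v(i := v j, j := v i)) + \<alpha> v = 0"
    using zero[of "v i + v j"] zero[of "v i"] zero[of "v j"] by (simp add: add.commute)
  moreover have "v(i := v j, j := v i) = v \<circ> Transposition.transpose i j"
    by (auto simp: Transposition.transpose_def fun_eq_iff assms(2))
  ultimately show ?thesis by (simp only: eq_neg_iff_add_eq_0)
qed

text \<open>If \<open>\<beta>\<close> kills all but one of the vectors, only the permutations that put the remaining vector
  into the slot of \<open>\<beta>\<close> contribute to \<open>\<alpha> \<and> \<beta>\<close>, and they contribute equally.\<close>

lemma wedge1_case_option:
  fixes \<alpha> :: "('n::finite \<Rightarrow> complex ^ 'm::finite) \<Rightarrow> complex"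
  assumes alt: "alternating_form \<alpha>" and \<beta>: "\<And>i. \<beta> (e i) = 0"
  shows "wedge1 \<alpha> \<beta> (case_option N e) = (-1) ^ CARD('n) * \<beta> N * \<alpha> e"
proof -
  let ?v = "case_option N e"
  let ?t = "\<lambda>\<sigma>. of_int (sign \<sigma>) * \<beta> (?v (\<sigma> None)) * \<alpha> (\<lambda>i. ?v (\<sigma> (Some i)))"
  have inv: "of_int (sign \<sigma>) * \<alpha> (\<lambda>i. v (\<sigma> (Some i))) = \<alpha> (\<lambda>i. v (Some i))"
    if "\<sigma> permutes (range Some)" for \<sigma> :: "'n option \<Rightarrow> 'n option" and v
    using that finite[of "range Some"]
  proof (induction arbitrary: v rule: permutes_induct)
    case (swap a b \<sigma>)
    then obtain i j where ab: "a = Some i" "b = Some j" "i \<noteq> j" by auto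
    let ?w = "v \<circ> Transposition.transpose a b"
    have "of_int (sign \<sigma>) * \<alpha> (\<lambda>i. ?w (\<sigma> (Some i))) = \<alpha> (\<lambda>i. ?w (Some i))"
      by (rule swap.IH)
    also have "(\<lambda>i. ?w (Some i)) = (\<lambda>i. v (Some i)) \<circ> Transposition.transpose i j"
      by (auto simp: ab Transposition.transpose_def fun_eq_iff)
    also have "\<alpha> \<dots> = - \<alpha> (\<lambda>i. v (Some i))"
      using alternating_form_swap[OF alt \<open>i \<noteq> j\<close>] .
    moreover have "sign (Transposition.transpose a b \<circ> \<sigma>) = - sign \<sigma>"
      using swap by (simp add: sign_compose sign_swap_id permutation_swap_id permutes_imp_permutation[OF _ swap.hyps(4)])
    ultimately show ?case by (simp add: o_def)
  qed simp_all
  have "(\<Sum>\<sigma> | \<sigma> permutes (UNIV :: 'n option set). ?t \<sigma>) =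
    (\<Sum>\<sigma> | \<sigma> permutes (range Some :: 'n option set). ?t \<sigma>)"
  proof (rule sum.mono_neutral_right)
    show "\<forall>\<sigma> \<in> {\<sigma>. \<sigma> permutes UNIV} - {\<sigma>. \<sigma> permutes (range Some)}. ?t \<sigma> = 0"
    proof
      fix \<sigma> :: "'n option \<Rightarrow> 'n option"
      assume \<sigma>: "\<sigma> \<in> {\<sigma>. \<sigma> permutes UNIV} - {\<sigma>. \<sigma> permutes (range Some)}"
      have "\<sigma> None \<noteq> None"
      proof
        assume "\<sigma> None = None"
        then have "\<sigma> x = x" if "x \<notin> range Some" for x
          using that by (cases x) auto
        with \<sigma> show False by (auto simp: permutes_def)
      qed
      then show "?t \<sigma> = 0" by (auto simp: \<beta>)
    qed
  qed (auto intro: permutes_subset)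
  also have "\<dots> = (\<Sum>\<sigma> | \<sigma> permutes (range Some :: 'n option set). \<beta> N * \<alpha> e)"
  proof (rule sum.cong)
    fix \<sigma> :: "'n option \<Rightarrow> 'n option" assume "\<sigma> \<in> {\<sigma>. \<sigma> permutes (range Some)}"
    moreover from this have "\<sigma> None = None" by (auto simp: permutes_def)
    ultimately show "?t \<sigma> = \<beta> N * \<alpha> e" using inv[of \<sigma> ?v] by (simp add: mult_ac)
  qed simp
  also have "\<dots> = fact CARD('n) * (\<beta> N * \<alpha> e)"
    by (simp add: card_permutations[of _ "CARD('n)"] card_image)
  finally show ?thesis by (simp add: wedge1_def)
qed

lemma det_add_multiples_of_row:
  fixes M :: "'a::comm_ring_1 ^ 'm::finite ^ 'm"
  assumes "b \<notin> F"
  shows "det (\<chi> j. if j \<in> F then row j M + t j *s row b M else row j M) = det M"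
  using finite[of F] assms
proof (induction F rule: finite_induct)
  case empty
  then show ?case by (simp add: row_def)
next
  case (insert a F)
  let ?M = "\<chi> j. if j \<in> F then row j M + t j *s row b M else row j M"
  have row: "row j ?M = ?M $ j" for j by (simp add: row_def vec_eq_iff)
  have "(\<chi> j. if j \<in> insert a F then row j M + t j *s row b M else row j M) =
    (\<chi> k. if k = a then row a ?M + t a *s row b ?M else row k ?M)"
    unfolding row using insert by (auto simp: vec_eq_iff)
  moreover have "det \<dots> = det ?M" using insert.prems by (intro det_row_operation) auto
  ultimately show ?case using insert by simp
qed

lemma det_complex_of_real:
  "det (\<chi> i j. complex_of_real (R $ i $ j)) = of_real (det (R :: real ^ 'm::finite ^ 'm))"
  by (simp add: det_def)

lemma det_eq_0_of_kernel:
  fixes M :: "'a::field ^ 'm::finite ^ 'm"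
  assumes "M *v x = 0" "x \<noteq> 0"
  shows "det M = 0"
proof (rule ccontr)
  assume "det M \<noteq> 0"
  then have "\<exists>B. B ** M = mat 1" by (simp add: invertible_det_nz[symmetric] invertible_left_inverse)
  with assms show False by (simp add: matrix_left_invertible_ker)
qed

lemma prod_UNIV_option:
  "prod f (UNIV :: 'n::finite option set) = f None * (\<Prod>k\<in>UNIV. f (Some k))"
  by (simp add: UNIV_option_conv prod.reindex)

text \<open>
  The rows are those of \<open>z = \<gamma> e + \<rho> x\<close> and of \<open>a\<^sub>k y + \<rho> \<eta>\<^sub>k\<close>, where \<open>y = \<gamma>' e + \<rho>' x\<close>. The two relations
  from the quadric give \<open>y = (\<rho>'/\<rho>) z + (\<gamma>'/\<rho>\<^sup>2) e\<close>, so row operations with the row \<open>z\<close> turn every \<open>y\<close>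
  into a multiple of \<open>e\<close>. Next the summand \<open>\<gamma> e\<close> of \<open>z\<close> may be dropped, because \<open>e\<close> and the \<open>\<eta>\<^sub>k\<close> are all
  orthogonal to \<open>x\<close> and hence dependent. In what remains the column \<open>None\<close> carries the factor \<open>\<gamma>'/\<rho>\<^sup>2\<close>
  and every other column the factor \<open>\<rho>\<close>, and the rest is a real matrix. Multiplying these factors
  produces the power \<open>n - 2\<close>.
\<close>

lemma det_frame:
  fixes x e :: "'n::finite rvec" and \<eta> :: "'n \<Rightarrow> 'n rvec" and a :: "'n \<Rightarrow> real"
  assumes n: "CARD('n) \<ge> 2"
    and x: "x \<noteq> 0" "x $ None = 0" and e: "\<And>k. e $ Some k = 0"
    and \<eta>: "\<And>k. \<eta> k $ None = 0" "\<And>k. x \<bullet> \<eta> k = 0"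
    and quadric: "\<gamma>\<^sup>2 + \<rho>\<^sup>2 = 1" "\<gamma> * \<gamma>' + \<rho> * \<rho>' = 0" "\<rho> \<noteq> 0"
  shows "det (\<chi> j i. case j of None \<Rightarrow> \<gamma> * of_real (e $ i) + \<rho> * of_real (x $ i)
      | Some k \<Rightarrow> of_real (a k) * (\<gamma>' * of_real (e $ i) + \<rho>' * of_real (x $ i)) + \<rho> * of_real (\<eta> k $ i))
    = \<gamma>' * \<rho> ^ (CARD('n) - 2) * complex_of_real (det (\<chi> j. case j of None \<Rightarrow> x | Some k \<Rightarrow> a k *\<^sub>R e + \<eta> k))"
    (is "det ?T = _ * _ * complex_of_real (det ?R)")
proof -
  let ?c = "\<lambda>v::'n rvec. (\<chi> i. complex_of_real (v $ i))"
  \<comment> \<open>the coefficient of \<open>e\<close> in \<open>y\<close>, modulo \<open>z\<close>\<close>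
  define c where "c = \<gamma>' / \<rho>\<^sup>2"
  let ?b = "\<lambda>k. (of_real (a k) * c) *s ?c e + \<rho> *s ?c (\<eta> k)"
  let ?z = "\<gamma> *s ?c e + \<rho> *s ?c x"
  let ?T1 = "\<chi> j. case j of None \<Rightarrow> ?z | Some k \<Rightarrow> ?b k"
  let ?row = "\<lambda>z j. if j = None then z else case_option 0 ?b j"
  have c: "\<gamma>' = \<rho>' / \<rho> * \<gamma> + c"
  proof -
    from quadric(1,2) have "\<rho>\<^sup>2 * \<gamma>' = (\<rho> * \<rho>') * \<gamma> + \<gamma>'" by algebra
    then have "\<rho>\<^sup>2 * \<gamma>' / \<rho>\<^sup>2 = ((\<rho> * \<rho>') * \<gamma> + \<gamma>') / \<rho>\<^sup>2" by (rule arg_cong)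
    also have "\<rho>\<^sup>2 * \<gamma>' / \<rho>\<^sup>2 = \<gamma>'" using quadric(3) by simp
    finally show ?thesis
      using quadric(3) by (simp only: c_def add_divide_distrib) (simp add: power2_eq_square)
  qed
  let ?t = "case_option 0 (\<lambda>k. of_real (a k) * \<rho>' / \<rho>)"
  have "?T = (\<chi> j. if j \<in> range Some then row j ?T1 + ?t j *s row None ?T1 else row j ?T1)"
    (is "_ = ?T2")
  proof -
    have "?T $ j $ i = ?T2 $ j $ i" for i j
    proof (cases j)
      case None
      then show ?thesis by (simp add: row_def)
    next
      case (Some k)
      have "of_real (a k) * (\<gamma>' * of_real (e $ i) + \<rho>' * of_real (x $ i)) =
        of_real (a k) * c * of_real (e $ i) +
        of_real (a k) * \<rho>' / \<rho> * (\<gamma> * of_real (e $ i) + \<rho> * of_real (x $ i))"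
        by (subst c) (simp add: quadric(3) algebra_simps)
      then show ?thesis unfolding Some by (simp add: row_def)
    qed
    then show ?thesis by (simp only: vec_eq_iff) blast
  qed
  then have "det ?T = det ?T2" by (rule arg_cong)
  also have "\<dots> = det ?T1" by (rule det_add_multiples_of_row) simp
  also have "?T1 = (\<chi> j. if j = None then \<gamma> *s ?c e + \<rho> *s ?c x else case_option 0 ?b j)"
    by (auto simp: vec_eq_iff split: option.splits)
  also have "det \<dots> = det (\<chi> j. ?row (\<gamma> *s ?c e) j) + det (\<chi> j. ?row (\<rho> *s ?c x) j)"
    by (rule det_row_add)
  also have "det (\<chi> j. ?row (\<gamma> *s ?c e) j) = 0"
  proof -
    have ip: "(\<Sum>i\<in>UNIV. (\<alpha> * of_real (v $ i) + \<beta> * of_real (w $ i)) * complex_of_real (x $ i)) =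
      \<alpha> * of_real (x \<bullet> v) + \<beta> * of_real (x \<bullet> w)" for \<alpha> \<beta> v w
      by (simp add: inner_vec_def sum_distrib_left sum.distrib algebra_simps)
    have "x $ i \<bullet> e $ i = 0" for i by (cases i) (simp_all add: x e)
    then have xe: "x \<bullet> e = 0" by (simp only: inner_vec_def sum.neutral_const)
    have "((\<chi> j. ?row (\<gamma> *s ?c e) j) *v ?c x) $ j = 0" for j
      using ip[of \<gamma> e 0 0] ip[of _ e] xe \<eta>(2) by (cases j) (simp_all add: matrix_vector_mult_def)
    then have "(\<chi> j. ?row (\<gamma> *s ?c e) j) *v ?c x = 0" by (simp only: vec_eq_iff zero_index) blast
    moreover have "?c x \<noteq> 0" using x by (auto simp: vec_eq_iff)
    ultimately show ?thesis by (rule det_eq_0_of_kernel)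
  qed
  also have "(\<chi> j. ?row (\<rho> *s ?c x) j) =
    transpose (\<chi> i. (if i = None then c else \<rho>) *s (\<chi> j. complex_of_real (?R $ j $ i)))"
    (is "?T3 = ?T4")
  proof -
    have "?T3 $ j $ i = ?T4 $ j $ i" for i j
      by (cases j; cases i) (simp_all add: transpose_def x e \<eta> ring_distribs mult_ac)
    then show ?thesis by (simp only: vec_eq_iff) blast
  qed
  also have "det \<dots> = c * \<rho> ^ CARD('n) * det (\<chi> i j. complex_of_real (transpose ?R $ i $ j))"
    by (simp only: det_transpose det_rows_mul) (simp add: prod_UNIV_option transpose_def)
  also have "\<dots> = \<gamma>' * \<rho> ^ (CARD('n) - 2) * of_real (det ?R)"
  proof -
    have "\<rho> ^ CARD('n) = \<rho> ^ (2 + (CARD('n) - 2))" using n by (simp only: le_add_diff_inverse)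
    then have "\<rho> ^ CARD('n) = \<rho>\<^sup>2 * \<rho> ^ (CARD('n) - 2)" by (simp only: power_add)
    then show ?thesis using quadric(3) by (simp add: c_def det_complex_of_real det_transpose)
  qed
  finally show ?thesis by simp
qed

section \<open>The Stenzel form\<close>

lemma rsq_eq_inner: "rsq z = z \<bullet> z"
  by (simp add: rsq_def inner_vec_def Re_sum inner_complex_def)

lemma has_derivative_rsq: "(rsq has_derivative (\<lambda>h. 2 * (z \<bullet> h))) (at z)"
proof -
  have "((\<lambda>z. z \<bullet> z) has_derivative (\<lambda>h. z \<bullet> h + h \<bullet> z)) (at z)"
    by (intro has_derivative_inner has_derivative_ident)
  then show ?thesis by (simp add: rsq_eq_inner[abs_def] inner_commute)
qed

text \<open>Here \<open>\<theta>\<close> is \<open>\<partial> rsq\<close>: the formula is \<open>i \<partial>\<partial>bar u(r\<^sup>2) = i (u' \<partial>\<partial>bar r\<^sup>2 + u'' \<partial> r\<^sup>2 \<and> \<partial>bar r\<^sup>2)\<close>.\<close>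

lemma i_ddbar_comp_rsq:
  fixes z v w :: "'n::finite cvec"
  assumes W: "open W" "rsq z \<in> W"
    and u: "\<And>x. x \<in> W \<Longrightarrow> (u has_real_derivative u' x) (at x)"
    and u': "(u' has_real_derivative u'') (at (rsq z))"
  defines "\<theta> \<equiv> \<lambda>v. \<Sum>j\<in>UNIV. cnj (z $ j) * v $ j"
  shows "i_ddbar (\<lambda>y. complex_of_real (u (rsq y))) z v w =
    \<i> * (of_real (u' (rsq z)) * ((\<Sum>j\<in>UNIV. v $ j * cnj (w $ j)) - (\<Sum>j\<in>UNIV. w $ j * cnj (v $ j))) +
      of_real u'' * (\<theta> v * cnj (\<theta> w) - \<theta> w * cnj (\<theta> v)))"
proof -
  let ?F = "\<lambda>y :: 'n cvec. complex_of_real (u (rsq y))"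
  have bar: "wirtinger_bar k ?F y = of_real (u' (rsq y)) * y $ k" if "rsq y \<in> W" for k y
  proof -
    have "(?F has_derivative (\<lambda>h. of_real (u' (rsq y) * (2 * (y \<bullet> h))))) (at y)"
      using has_derivative_compose[OF has_derivative_rsq[of y] u[OF that, unfolded has_field_derivative_def]]
      by (intro has_derivative_of_real) simp
    note d = frechet_derivative_at[OF this, symmetric]
    show ?thesis unfolding wirtinger_bar_def d
      by (simp add: inner_axis inner_complex_def complex_eq_iff)
  qed
  have "wirtinger j (wirtinger_bar k ?F) z =
    of_real u'' * cnj (z $ j) * z $ k + of_real (u' (rsq z)) * (if j = k then 1 else 0)" for j k
  proof -
    let ?D = "\<lambda>h. of_real (u' (rsq z)) * h $ k + of_real (u'' * (2 * (z \<bullet> h))) * z $ k"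
    have "((\<lambda>y. complex_of_real (u' (rsq y)) * y $ k) has_derivative ?D) (at z)"
      using has_derivative_compose[OF has_derivative_rsq[of z] u'[unfolded has_field_derivative_def]]
      by (intro has_derivative_mult has_derivative_of_real bounded_linear_imp_has_derivative
          bounded_linear_vec_nth) simp
    moreover have "open {y :: 'n cvec. rsq y \<in> W}"
    proof -
      have "continuous_on UNIV (rsq :: 'n cvec \<Rightarrow> real)"
        unfolding rsq_eq_inner[abs_def] by (intro continuous_intros)
      then show ?thesis using W(1) by (simp add: continuous_on_open_vimage vimage_def)
    qed
    ultimately have "(wirtinger_bar k ?F has_derivative ?D) (at z)"
      by (rule has_derivative_transform_within_open) (use W(2) bar in simp_all)
    note d = frechet_derivative_at[OF this, symmetric]
    have "axis j c $ k = (if j = k then c else 0)" for c :: complex by (simp add: axis_def)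
    then show ?thesis unfolding wirtinger_def d
      by (simp add: inner_axis inner_complex_def complex_eq_iff algebra_simps add_divide_distrib
          diff_divide_distrib)
  qed
  then have "i_ddbar ?F z v w = \<i> * (\<Sum>j\<in>UNIV. \<Sum>k\<in>UNIV.
      of_real u'' * (cnj (z $ j) * v $ j * cnj (cnj (z $ k) * w $ k) -
        cnj (z $ j) * w $ j * cnj (cnj (z $ k) * v $ k)) +
      (if j = k then of_real (u' (rsq z)) * (v $ j * cnj (w $ k) - w $ j * cnj (v $ k)) else 0))"
    unfolding i_ddbar_def
    by (intro arg_cong2[of _ _ _ _ "(*)"] refl sum.cong) (simp add: algebra_simps)
  also have "(\<Sum>j\<in>UNIV. \<Sum>k\<in>UNIV. of_real u'' * (cnj (z $ j) * v $ j * cnj (cnj (z $ k) * w $ k) -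
        cnj (z $ j) * w $ j * cnj (cnj (z $ k) * v $ k)) +
      (if j = k then of_real (u' (rsq z)) * (v $ j * cnj (w $ k) - w $ j * cnj (v $ k)) else 0)) =
    of_real u'' * (\<theta> v * cnj (\<theta> w) - \<theta> w * cnj (\<theta> v)) +
    of_real (u' (rsq z)) * ((\<Sum>j\<in>UNIV. v $ j * cnj (w $ j)) - (\<Sum>j\<in>UNIV. w $ j * cnj (v $ j)))"
    unfolding \<theta>_def cnj_sum sum_product
    by (simp add: sum.distrib sum_subtractf right_diff_distrib flip: sum_distrib_left)
  finally show ?thesis by (simp only: add.commute)
qed

lemma smooth_on_imp_two_derivatives:
  fixes u :: "real \<Rightarrow> real"
  assumes "open W" "smooth_on W u"
  shows "\<exists>u' u''. \<forall>x\<in>W. (u has_real_derivative u' x) (at x) \<and> (u' has_real_derivative u'' x) (at x)"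
proof -
  have field: "(f has_real_derivative D 1) (at x)"
    if "(f has_derivative D) (at x within W)" "x \<in> W" for f D x
  proof -
    have f: "(f has_derivative D) (at x)" using that at_within_open[OF that(2) assms(1)] by simp
    have "D h = D 1 * h" for h
      using linear.scaleR[OF has_derivative_linear[OF f], of h 1]
      by simp
    then show ?thesis
      unfolding has_field_derivative_def by (intro has_derivative_eq_rhs[OF f] ext)
  qed
  have "Ck_on (Suc (Suc 0)) W u" using assms(2) unfolding smooth_on_def by blast
  then obtain D where D: "\<forall>x\<in>W. (u has_derivative D x) (at x within W)"
    "Ck_on (Suc 0) W (\<lambda>x. D x 1)" by (metis Ck_on.simps(2))
  then obtain E where E: "\<forall>x\<in>W. ((\<lambda>x. D x 1) has_derivative E x) (at x within W)" by auto
  show ?thesis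
    by (rule exI[of _ "\<lambda>x. D x 1"], rule exI[of _ "\<lambda>x. E x 1"], intro ballI conjI)
      (rule field[OF D(1)[rule_format]] field[OF E[rule_format]]; assumption)+
qed

text \<open>Both terms of \<open>i \<partial>\<partial>bar u(r\<^sup>2)\<close> are imaginary parts of the two complex numbers that are assumed real
  below, up to real factors. So isotropy for the Stenzel form can be seen without knowing \<open>u\<close>.\<close>

lemma stenzel_form_eq_0:
  assumes "stenzel_form \<omega>" and z: "z \<in> complex_sphere" and v: "v \<in> tangent_Q z" "w \<in> tangent_Q z"
  defines "\<theta> \<equiv> \<lambda>v. \<Sum>j\<in>UNIV. cnj (z $ j) * v $ j"
  assumes "(\<Sum>j\<in>UNIV. v $ j * cnj (w $ j)) \<in> \<real>" and "\<theta> v * cnj (\<theta> w) \<in> \<real>"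
  shows "\<omega> z v w = 0"
proof -
  obtain u W where W: "open W" "{1..} \<subseteq> W" "smooth_on W u" and
    all: "\<forall>z\<in>complex_sphere. \<forall>v\<in>tangent_Q z. \<forall>w\<in>tangent_Q z.
      complex_of_real (\<omega> z v w) = i_ddbar (\<lambda>y. complex_of_real (u (rsq y))) z v w"
    using assms(1)[unfolded stenzel_form_def, THEN conjunct1]
    by (elim exE conjE) (rule that; assumption)
  note \<omega> = all[rule_format, OF z v]
  obtain u' u'' where u: "\<forall>x\<in>W. (u has_real_derivative u' x) (at x) \<and> (u' has_real_derivative u'' x) (at x)"
    using smooth_on_imp_two_derivatives[OF W(1,3)] by blast
  \<comment> \<open>the function \<open>u\<close> is controlled on \<open>{1..}\<close> only\<close>
  have "1 = norm (quad z)" using z by (simp add: complex_sphere_def)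
  also have "\<dots> \<le> (\<Sum>j\<in>UNIV. norm ((z $ j)\<^sup>2))" unfolding quad_def by (rule norm_sum)
  also have "\<dots> = rsq z" unfolding rsq_eq_inner inner_vec_def dot_square_norm norm_power ..
  finally have r: "rsq z \<in> W" using W(2) by auto
  have 1: "(\<Sum>j\<in>UNIV. v $ j * cnj (w $ j)) - (\<Sum>j\<in>UNIV. w $ j * cnj (v $ j)) = 0"
    using Reals_cnj_iff[THEN iffD1, OF assms(6)] by (simp add: mult.commute)
  have 2: "\<theta> v * cnj (\<theta> w) - \<theta> w * cnj (\<theta> v) = 0"
    using Reals_cnj_iff[THEN iffD1, OF assms(7)] by (simp add: mult.commute)
  have "complex_of_real (\<omega> z v w) = 0"
    unfolding \<omega> using 1 2
    by (subst i_ddbar_comp_rsq[OF W(1) r, of u u' "u'' (rsq z)"]) (use u r in \<open>simp_all add: \<theta>_def\<close>)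
  then show ?thesis by simp
qed

section \<open>The quadric\<close>

lemma has_derivative_quad:
  "(quad has_derivative (\<lambda>h. 2 * (\<Sum>j\<in>UNIV. z $ j * h $ j))) (at z)"
  unfolding quad_def[abs_def] power2_eq_square
  by (rule derivative_eq_intros bounded_linear_imp_has_derivative[OF bounded_linear_vec_nth] refl)+
    (simp add: fun_eq_iff sum_distrib_left mult.commute)

lemma tangent_Q_iff: "v \<in> tangent_Q z \<longleftrightarrow> (\<Sum>j\<in>UNIV. z $ j * v $ j) = 0"
  by (simp add: tangent_Q_def frechet_derivative_at[OF has_derivative_quad, symmetric])

text \<open>As \<open>quad\<close> is homogeneous of degree 2, its differential at \<open>z\<close> takes the value 2 on the radial
  vector \<open>z\<close>, and contracting the defining relation with \<open>z\<close> yields \<open>\<Omega>\<close>.\<close>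

lemma holomorphic_volume_form_tangent:
  fixes \<Omega> :: "'n::finite cvec \<Rightarrow> ('n \<Rightarrow> 'n cvec) \<Rightarrow> complex"
  assumes \<Omega>: "holomorphic_volume_form \<Omega>" and z: "z \<in> complex_sphere"
    and e: "\<And>i. e i \<in> tangent_Q z"
  shows "\<Omega> z e = (-1) ^ CARD('n) / 2 * dz_volume (case_option z e)"
proof -
  let ?\<beta> = "frechet_derivative (\<lambda>y. quad y - 1) (at z)"
  have \<beta>: "?\<beta> = (\<lambda>h. 2 * (\<Sum>j\<in>UNIV. z $ j * h $ j))"
    using has_derivative_diff[OF has_derivative_quad has_derivative_const]
    by (intro frechet_derivative_at[symmetric]) simp
  have "?\<beta> z = 2" unfolding \<beta> using z by (simp add: complex_sphere_def quad_def power2_eq_square)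
  moreover have "?\<beta> (e i) = 0" for i using e[of i] by (simp add: \<beta> tangent_Q_iff)
  moreover have "alternating_form (\<Omega> z)" "wedge1 (\<Omega> z) ?\<beta> (case_option z e) = dz_volume (case_option z e)"
    using \<Omega> z unfolding holomorphic_volume_form_def by blast+
  ultimately have "dz_volume (case_option z e) = (-1) ^ CARD('n) * 2 * \<Omega> z e"
    using wedge1_case_option[of "\<Omega> z" ?\<beta> e z] by simp
  then show ?thesis by (simp add: mult.assoc flip: power_mult_distrib power_add)
qed

section \<open>The map \<open>X\<^sub>p\<^sub>,\<^sub>\<gamma>\<close>\<close>

text \<open>The values of \<open>X\<^sub>p\<^sub>,\<^sub>\<gamma>\<close> at \<open>(s, x)\<close> and of its differential all have complex coordinates with respect
  to real vectors \<open>p\<close>, \<open>b = A x\<close> and \<open>y = A \<eta>\<close> that are pairwise orthogonal, so that bilinear and Hermitian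
  products of them reduce to the coordinates.\<close>

definition frame_vec ::
  "'n::finite rvec \<Rightarrow> 'n rvec \<Rightarrow> 'n rvec \<Rightarrow> complex \<Rightarrow> complex \<Rightarrow> complex \<Rightarrow> 'n cvec" where
  "frame_vec p b y \<alpha> \<beta> \<kappa> =
     (\<chi> j. \<alpha> * of_real (p $ j) + \<beta> * of_real (b $ j) + \<kappa> * of_real (y $ j))"

lemma X_map_eq: "X_map p A \<gamma> \<rho> (s, x) = frame_vec p (A *v x) y (\<gamma> s) (\<rho> s) 0"
  by (simp add: X_map_def frame_vec_def)

lemma cnj_frame_vec: "cnj (frame_vec p b y \<alpha> \<beta> \<kappa> $ j) = frame_vec p b y (cnj \<alpha>) (cnj \<beta>) (cnj \<kappa>) $ j"
  by (simp add: frame_vec_def)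

lemma sum_frame_vec:
  assumes "p \<bullet> p = 1" "b \<bullet> b = 1" "p \<bullet> b = 0" "p \<bullet> y = 0" "b \<bullet> y = 0" "p \<bullet> y' = 0" "b \<bullet> y' = 0"
  shows "(\<Sum>j\<in>UNIV. frame_vec p b y \<alpha> \<beta> \<kappa> $ j * frame_vec p b y' \<alpha>' \<beta>' \<kappa>' $ j) =
    \<alpha> * \<alpha>' + \<beta> * \<beta>' + \<kappa> * \<kappa>' * of_real (y \<bullet> y')"
proof -
  let ?c = "\<lambda>v w :: 'a rvec. (\<Sum>j\<in>UNIV. complex_of_real (v $ j) * of_real (w $ j))"
  have c: "?c v w = of_real (v \<bullet> w)" for v w by (simp add: inner_vec_def)
  have "(\<Sum>j\<in>UNIV. frame_vec p b y \<alpha> \<beta> \<kappa> $ j * frame_vec p b y' \<alpha>' \<beta>' \<kappa>' $ j) =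
    \<alpha> * \<alpha>' * ?c p p + \<alpha> * \<beta>' * ?c p b + \<alpha> * \<kappa>' * ?c p y' +
    \<beta> * \<alpha>' * ?c b p + \<beta> * \<beta>' * ?c b b + \<beta> * \<kappa>' * ?c b y' +
    \<kappa> * \<alpha>' * ?c y p + \<kappa> * \<beta>' * ?c y b + \<kappa> * \<kappa>' * ?c y y'"
    unfolding sum_distrib_left sum.distrib[symmetric]
    by (intro sum.cong refl) (simp add: frame_vec_def algebra_simps)
  also have "\<dots> = \<alpha> * \<alpha>' + \<beta> * \<beta>' + \<kappa> * \<kappa>' * of_real (y \<bullet> y')"
    unfolding c using assms by (simp add: inner_commute)
  finally show ?thesis .
qed

lemma has_derivative_X_map:
  assumes "(\<gamma> has_vector_derivative \<gamma>') (at s within I)" "(\<rho> has_vector_derivative \<rho>') (at s within I)"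
  shows "(X_map p A \<gamma> \<rho> has_derivative
      (\<lambda>(a, \<eta>). frame_vec p (A *v x) (A *v \<eta>) (of_real a * \<gamma>') (of_real a * \<rho>') (\<rho> s)))
    (at (s, x) within I \<times> E)"
proof (rule has_derivative_vec)
  fix j
  have fst: "((\<lambda>q. f (fst q)) has_derivative (\<lambda>h. fst h *\<^sub>R f')) (at (s, x) within I \<times> E)"
    if "(f has_vector_derivative f') (at s within I)" for f :: "real \<Rightarrow> complex" and f'
  proof -
    have "(f has_derivative (\<lambda>h. h *\<^sub>R f')) (at (fst (s, x)) within fst ` (I \<times> E))"
      using that unfolding has_vector_derivative_def by (auto elim!: has_derivative_subset)
    then show ?thesis
      by (rule has_derivative_in_compose[rotated])
        (intro bounded_linear_imp_has_derivative bounded_linear_fst)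
  qed
  have snd: "((\<lambda>q. complex_of_real ((A *v snd q) $ j)) has_derivative
    (\<lambda>q. complex_of_real ((A *v snd q) $ j))) (at (s, x) within I \<times> E)"
    by (intro has_derivative_of_real bounded_linear_imp_has_derivative
        bounded_linear_compose[OF bounded_linear_vec_nth
          bounded_linear_compose[OF matrix_vector_mul_bounded_linear bounded_linear_snd]])
  have "((\<lambda>q. \<gamma> (fst q) * of_real (p $ j) + \<rho> (fst q) * of_real ((A *v snd q) $ j)) has_derivative
    (\<lambda>h. (fst h *\<^sub>R \<gamma>') * of_real (p $ j) +
      (\<rho> (fst (s, x)) * of_real ((A *v snd h) $ j) + (fst h *\<^sub>R \<rho>') * of_real ((A *v snd (s, x)) $ j))))
    (at (s, x) within I \<times> E)"
    by (intro has_derivative_add has_derivative_mult has_derivative_mult_left fst snd assms)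
  then show "((\<lambda>q. X_map p A \<gamma> \<rho> q $ j) has_derivative (\<lambda>h. (case h of (a, \<eta>) \<Rightarrow>
      frame_vec p (A *v x) (A *v \<eta>) (of_real a * \<gamma>') (of_real a * \<rho>') (\<rho> s)) $ j)) (at (s, x) within I \<times> E)"
    by (simp add: X_map_def frame_vec_def case_prod_unfold scaleR_conv_of_real algebra_simps)
qed

lemma smooth_on_X_map:
  assumes "smooth_on I \<gamma>" "smooth_on I \<rho>"
  shows "smooth_on (I \<times> E) (X_map p A \<gamma> \<rho>)"
  unfolding smooth_on_def
proof
  fix k
  have "Ck_on k (I \<times> E) (\<lambda>q. complex_of_real ((A *v snd q) $ j))" for j
    by (intro Ck_on_bounded_linear bounded_linear_compose[OF bounded_linear_of_real]
        bounded_linear_compose[OF bounded_linear_vec_nth]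
        bounded_linear_compose[OF matrix_vector_mul_bounded_linear bounded_linear_snd])
  with assms have "Ck_on k (I \<times> E)
    (\<lambda>q. \<gamma> (fst q) * of_real (p $ j) + \<rho> (fst q) * of_real ((A *v snd q) $ j))" for j
    unfolding smooth_on_def
    by (intro Ck_on_add Ck_on_mult Ck_on_const) (simp_all add: Ck_on_fst)
  then show "Ck_on k (I \<times> E) (X_map p A \<gamma> \<rho>)"
    by (intro Ck_on_vec) (simp add: X_map_def case_prod_unfold)
qed

text \<open>Tangent vectors of the product split into a multiple of the velocity of \<open>s\<close>, which may only be
  one-sided at an end point of \<open>I\<close>, and the velocity of a great circle.\<close>

lemma tangent_prod_derivative_unique:
  fixes f :: "real \<times> 'n::finite rvec \<Rightarrow> 'b::real_normed_vector"
  assumes D: "(f has_derivative D) (at (s, x) within I \<times> equator)"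
    and E: "(f has_derivative E) (at (s, x) within I \<times> equator)"
    and s: "s \<in> I" "at s within I \<noteq> bot" and x: "x \<in> equator" and w: "w \<in> tangent_prod (s, x)"
  shows "D w = E w"
proof -
  obtain a \<eta> where w_eq: "w = (a, \<eta>)" by (cases w)
  have \<eta>: "\<eta> $ None = 0" "x \<bullet> \<eta> = 0" using w by (simp_all add: w_eq tangent_prod_def)
  have x': "x \<bullet> x = 1" "x $ None = 0" using x by (simp_all add: equator_def norm_eq_1)
  have 1: "D (1, 0) = E (1, 0)"
  proof (rule has_derivative_unique_on_velocity[where c = "\<lambda>t. (t, x)" and t = s])
    show "((\<lambda>t. (t, x)) has_vector_derivative (1, 0)) (at s within I)"
      by (intro has_vector_derivative_Pair has_vector_derivative_id has_vector_derivative_const)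
  qed (use assms in auto)
  let ?k = "norm \<eta>"
  \<comment> \<open>for \<open>\<eta> = 0\<close> this is the constant curve \<open>x\<close>, so that case needs no separate treatment\<close>
  let ?c = "\<lambda>t. cos (?k * t) *\<^sub>R x + sin (?k * t) *\<^sub>R (\<eta> /\<^sub>R ?k)"
  have 2: "D (0, \<eta>) = E (0, \<eta>)"
  proof (rule has_derivative_unique_on_velocity[where c = "\<lambda>t. (s, ?c t)" and t = 0 and J = UNIV])
    have "(?c has_vector_derivative
      ((- sin (?k * 0) * ?k) *\<^sub>R x + (cos (?k * 0) * ?k) *\<^sub>R (\<eta> /\<^sub>R ?k))) (at 0)"
      by (auto intro!: derivative_eq_intros simp: has_real_derivative_iff_has_vector_derivative[symmetric])
    moreover have "?k *\<^sub>R (\<eta> /\<^sub>R ?k) = \<eta>" by (cases "\<eta> = 0") simp_all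
    ultimately have "(?c has_vector_derivative \<eta>) (at 0)" by simp
    then show "((\<lambda>t. (s, ?c t)) has_vector_derivative (0, \<eta>)) (at 0)"
      by (intro has_vector_derivative_Pair has_vector_derivative_const)
    have "?c t \<bullet> ?c t = 1" for t
    proof (cases "\<eta> = 0")
      case False
      then have "(\<eta> /\<^sub>R ?k) \<bullet> (\<eta> /\<^sub>R ?k) = 1" by (simp add: dot_square_norm power2_eq_square)
      moreover have "x \<bullet> (\<eta> /\<^sub>R ?k) = 0" using \<eta> by simp
      moreover have "(c *\<^sub>R x + d *\<^sub>R y) \<bullet> (c *\<^sub>R x + d *\<^sub>R y) =
        c * c * (x \<bullet> x) + 2 * c * d * (x \<bullet> y) + d * d * (y \<bullet> y)" for c d y
        by (simp add: inner_add_left inner_add_right inner_commute algebra_simps)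
      ultimately show ?thesis
        by (simp only: x' sin_cos_squared_add3 mult_1_right mult_zero_right add_0_right)
    qed (simp add: x')
    then have "?c t \<in> equator" for t
      using x' \<eta> by (simp add: equator_def norm_eq_1)
    then show "(\<lambda>t. (s, ?c t)) ` UNIV \<subseteq> I \<times> equator" using s by auto
  qed (use D E in simp_all)
  have "L (a, \<eta>) = a *\<^sub>R L (1, 0) + L (0, \<eta>)" if "(f has_derivative L) F" for L F
  proof -
    have L: "linear L" using that by (rule has_derivative_linear)
    have "(a, \<eta>) = a *\<^sub>R (1, 0) + (0, \<eta>)" by simp
    then show ?thesis by (metis L linear_add linear_scale)
  qed
  from this[OF D] this[OF E] show ?thesis by (simp add: w_eq 1 2)
qed

text \<open>The rotation \<open>A\<close> is unimodular over the complex numbers, so it can be removed.\<close>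

lemma dz_volume_frame_vec:
  fixes A :: "real ^ ('n::finite option) ^ ('n option)"
  assumes "det A = 1"
  shows "dz_volume (case_option (frame_vec (A *v e) (A *v x) 0 \<gamma> \<rho> 0)
      (\<lambda>k. frame_vec (A *v e) (A *v x) (A *v \<eta> k) (of_real (a k) * \<gamma>') (of_real (a k) * \<rho>') \<rho>)) =
    det (\<chi> j i. case j of None \<Rightarrow> \<gamma> * of_real (e $ i) + \<rho> * of_real (x $ i)
      | Some k \<Rightarrow> of_real (a k) * (\<gamma>' * of_real (e $ i) + \<rho>' * of_real (x $ i)) + \<rho> * of_real (\<eta> k $ i))"
    (is "dz_volume ?v = det ?T")
proof -
  have "(\<chi> i j. ?v j $ i) = (\<chi> i j. complex_of_real (A $ i $ j)) ** transpose ?T" (is "?L = ?R")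
  proof -
    have "?L $ i $ j = ?R $ i $ j" for i j
      by (cases j) (simp_all add: frame_vec_def matrix_matrix_mult_def matrix_vector_mult_def transpose_def
          sum_distrib_left sum.distrib algebra_simps)
    then show ?thesis by (simp only: vec_eq_iff) blast
  qed
  then show ?thesis
    using assms by (simp add: dz_volume_def det_mul det_transpose det_complex_of_real)
qed

text \<open>Complete \<open>x\<close> to an orthonormal basis and split off the component of the other basis vectors along
  \<open>e\<close>, which is plus or minus the unit vector with index \<open>None\<close>.\<close>

lemma exists_tangent_frame:
  fixes e x :: "'n::finite rvec"
  assumes e: "e \<bullet> e = 1" "\<And>k. e $ Some k = 0" and x: "x \<bullet> x = 1" "x $ None = 0"
  shows "\<exists>(a :: 'n \<Rightarrow> real) (\<eta> :: 'n \<Rightarrow> 'n rvec). (\<forall>k. \<eta> k $ None = 0 \<and> x \<bullet> \<eta> k = 0) \<and>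
    det (\<chi> j. case j of None \<Rightarrow> x | Some k \<Rightarrow> a k *\<^sub>R e + \<eta> k) \<noteq> 0"
proof -
  obtain B where B: "orthogonal_matrix B" "B *v axis None 1 = x"
    using orthogonal_matrix_exists_basis[of x None] x(1) by (auto simp: norm_eq_1)
  define u where "u k = B *v axis (Some k) 1" for k
  define a where "a k = e $ None * u k $ None" for k
  define \<eta> where "\<eta> k = u k - axis None (u k $ None)" for k
  have ea: "e = axis None (e $ None)"
    unfolding vec_eq_iff
  proof
    fix j show "e $ j = axis None (e $ None) $ j" by (cases j) (simp_all add: axis_def e)
  qed
  have e2: "e $ None * e $ None = 1"
    using e(1) inner_axis[of e None "e $ None"] by (simp add: ea[symmetric])
  have dec: "a k *\<^sub>R e + \<eta> k = u k" for k
  proof -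
    have "a k *\<^sub>R e = axis None (u k $ None)"
      by (subst ea) (simp add: a_def vec_eq_iff axis_def e2 mult.commute mult.left_commute)
    then show ?thesis by (simp add: \<eta>_def)
  qed
  have ux: "x \<bullet> u k = 0" for k
  proof -
    have "orthogonal_transformation ((*v) B)"
      using B(1) by (simp add: orthogonal_transformation_matrix matrix_vector_mul_linear)
    then show ?thesis unfolding B(2)[symmetric] u_def
      by (simp add: orthogonal_transformation_def inner_axis_axis)
  qed
  have "(\<chi> j. case j of None \<Rightarrow> x | Some k \<Rightarrow> a k *\<^sub>R e + \<eta> k) = transpose B" (is "?R = _")
  proof -
    have "?R $ j = transpose B $ j" for j
      by (cases j) (simp_all add: dec u_def B(2)[symmetric] matrix_vector_mult_basis
          column_def transpose_def vec_eq_iff)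
    then show ?thesis by (rule vec_eq_iff[THEN iffD2, rule_format])
  qed
  moreover have "det B \<noteq> 0" using det_orthogonal_matrix[OF B(1)] by auto
  ultimately have "det ?R \<noteq> 0" by (simp add: det_transpose)
  moreover have "\<eta> k $ None = 0" "x \<bullet> \<eta> k = 0" for k
    using ux by (simp_all add: \<eta>_def inner_diff_right inner_axis x)
  ultimately show ?thesis by blast
qed

section \<open>The special Lagrangian condition\<close>

theorem mainTheorem3:
  fixes \<omega> :: "'n::finite cvec \<Rightarrow> 'n cvec \<Rightarrow> 'n cvec \<Rightarrow> real"
    and \<Omega> :: "'n cvec \<Rightarrow> ('n \<Rightarrow> 'n cvec) \<Rightarrow> complex"
    and p :: "'n rvec"
    and A :: "real ^ ('n option) ^ ('n option)"
    and I :: "real set"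
    and \<gamma> \<rho> :: "real \<Rightarrow> complex"
  assumes "CARD('n) \<ge> 2"
    and "stenzel_form \<omega>"
    and "holomorphic_volume_form \<Omega>"
    and "p \<in> sphere 0 1"
    and "rotation_matrix A"
    and "(\<lambda>x. A *v x) ` {x. x $ None = 0} = orthogonal_comp {p}"
    and "is_interval I" and "interior I \<noteq> {}"
    and "smooth_on I \<gamma>"
    and "\<forall>s\<in>I. vector_derivative \<gamma> (at s within I) \<noteq> 0"
    and "\<forall>s\<in>I. \<gamma> s \<noteq> 0 \<and> \<gamma> s \<noteq> 1 \<and> \<gamma> s \<noteq> -1"
    and "smooth_on I \<rho>"
    and "\<forall>s\<in>I. (\<rho> s)\<^sup>2 = 1 - (\<gamma> s)\<^sup>2"
  shows "X_map p A \<gamma> \<rho> ` (I \<times> equator) \<subseteq> complex_sphere \<and>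
    immersion_on (I \<times> equator) tangent_prod (X_map p A \<gamma> \<rho>) \<and>
    (special_lagrangian \<omega> \<Omega> (I \<times> equator) tangent_prod (X_map p A \<gamma> \<rho>) \<longleftrightarrow>
     (\<forall>s\<in>I. Im (vector_derivative \<gamma> (at s within I) * \<rho> s ^ (CARD('n) - 2)) = 0))"
proof -
  let ?n = "CARD('n)" and ?X = "X_map p A \<gamma> \<rho>"
  have "orthogonal_matrix A" and detA: "det A = 1"
    using assms(5) by (simp_all add: rotation_matrix_def)
  then have "orthogonal_transformation ((*v) A)"
    by (simp add: orthogonal_transformation_matrix matrix_vector_mul_linear)
  then have orth: "(A *v v) \<bullet> (A *v w) = v \<bullet> w" for v w
    by (simp add: orthogonal_transformation_def)
  \<comment> \<open>\<open>A\<close> maps \<open>{x. x $ None = 0}\<close> onto the complement of \<open>p\<close>, so \<open>p\<close> comes from the axis \<open>None\<close>\<close>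
  define e where "e = transpose A *v p"
  have p: "A *v e = p"
    unfolding e_def matrix_vector_mul_assoc
    using \<open>orthogonal_matrix A\<close> by (simp add: orthogonal_matrix_def)
  have ee: "e \<bullet> e = 1" using orth[of e e] assms(4) by (simp add: p norm_eq_1)
  have e: "e $ Some k = 0" for k
  proof -
    have "A *v axis (Some k) 1 \<in> orthogonal_comp {p}"
      unfolding assms(6)[symmetric] by (intro imageI) (simp add: axis_def)
    then have "p \<bullet> (A *v axis (Some k) 1) = 0"
      by (simp add: orthogonal_comp_def orthogonal_def inner_commute)
    then show ?thesis using orth[of e "axis (Some k) 1"] by (simp add: p inner_axis)
  qed
  have e_perp: "e \<bullet> y = 0" if "y $ None = 0" for y
  proof -
    have "e $ j \<bullet> y $ j = 0" for j by (cases j) (simp_all add: that e)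
    then show ?thesis by (simp only: inner_vec_def sum.neutral_const)
  qed

  define \<gamma>' where "\<gamma>' s = vector_derivative \<gamma> (at s within I)" for s
  define \<rho>' where "\<rho>' s = vector_derivative \<rho> (at s within I)" for s
  have lim: "at s within I \<noteq> bot" if "s \<in> I" for s
  proof -
    have "I \<noteq> {x}" for x using assms(8) by auto
    then have "s islimpt I"
      using connected_imp_perfect[of I s] assms(7) that by (simp add: is_interval_connected)
    then show ?thesis by (simp add: trivial_limit_within)
  qed
  have vd: "(f has_vector_derivative vector_derivative f (at s within I)) (at s within I)"
    if "smooth_on I f" "s \<in> I" for f :: "real \<Rightarrow> complex" and s
  proof -
    have "Ck_on (Suc 0) I f" using that(1) unfolding smooth_on_def by blast
    then have "f differentiable (at s within I)" using that(2) by (auto simp: differentiable_def)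
    then show ?thesis by (simp add: vector_derivative_works)
  qed
  note \<gamma>' = vd[OF assms(9), folded \<gamma>'_def] and \<rho>' = vd[OF assms(12), folded \<rho>'_def]
  have sq: "(\<gamma> s)\<^sup>2 + (\<rho> s)\<^sup>2 = 1" and \<rho>0: "\<rho> s \<noteq> 0" if "s \<in> I" for s
  proof -
    have "(\<rho> s)\<^sup>2 = 1 - (\<gamma> s)\<^sup>2" "\<gamma> s \<noteq> 1" "\<gamma> s \<noteq> -1" using assms(11,13) that by auto
    moreover from this have "(\<gamma> s)\<^sup>2 \<noteq> 1" by (simp add: power2_eq_1_iff)
    ultimately show "(\<gamma> s)\<^sup>2 + (\<rho> s)\<^sup>2 = 1" "\<rho> s \<noteq> 0" by auto
  qed
  have sq': "\<gamma> s * \<gamma>' s + \<rho> s * \<rho>' s = 0" if s: "s \<in> I" for s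
  proof -
    have "((\<lambda>t. \<gamma> t * \<gamma> t + \<rho> t * \<rho> t) has_vector_derivative
      (\<gamma> s * \<gamma>' s + \<gamma>' s * \<gamma> s) + (\<rho> s * \<rho>' s + \<rho>' s * \<rho> s)) (at s within I)"
      by (intro has_vector_derivative_add has_vector_derivative_mult \<gamma>' \<rho>' s)
    moreover have "((\<lambda>t. \<gamma> t * \<gamma> t + \<rho> t * \<rho> t) has_vector_derivative 0) (at s within I)"
      by (rule has_vector_derivative_transform[OF s _ has_vector_derivative_const[of 1]])
        (use sq in \<open>simp add: power2_eq_square\<close>)
    ultimately have "(\<gamma> s * \<gamma>' s + \<gamma>' s * \<gamma> s) + (\<rho> s * \<rho>' s + \<rho>' s * \<rho> s) = 0"
      by (rule vector_derivative_unique_within[OF lim[OF s]])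
    then have "2 * (\<gamma> s * \<gamma>' s + \<rho> s * \<rho>' s) = 0" by (simp add: algebra_simps)
    then show ?thesis by (simp only: mult_eq_0_iff) simp
  qed

  define V where "V x y = frame_vec p (A *v x) (A *v y)" for x y
  define dX where "dX s x = (\<lambda>(a, \<eta>). V x \<eta> (of_real a * \<gamma>' s) (of_real a * \<rho>' s) (\<rho> s))" for s x
  have X: "?X (s, x) = V x 0 (\<gamma> s) (\<rho> s) 0" for s x
    unfolding V_def by (rule X_map_eq)
  have dX: "(?X has_derivative dX s x) (at (s, x) within I \<times> equator)" if "s \<in> I" for s x
    unfolding dX_def V_def by (rule has_derivative_X_map[OF \<gamma>'[OF that] \<rho>'[OF that]])
  have eq: "x \<bullet> x = 1" "x $ None = 0" if "x \<in> equator" for x :: "'n rvec"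
    using that by (simp_all add: equator_def norm_eq_1)
  have tang: "y $ None = 0 \<and> x \<bullet> y = 0 \<longleftrightarrow> (a, y) \<in> tangent_prod (s, x)" for a s y and x :: "'n rvec"
    by (simp add: tangent_prod_def)
  have prods: "(\<Sum>j\<in>UNIV. V x y \<alpha> \<beta> \<kappa> $ j * V x y' \<alpha>' \<beta>' \<kappa>' $ j) =
    \<alpha> * \<alpha>' + \<beta> * \<beta>' + \<kappa> * \<kappa>' * of_real (y \<bullet> y')"
    if "x \<in> equator" "y $ None = 0 \<and> x \<bullet> y = 0" "y' $ None = 0 \<and> x \<bullet> y' = 0" for x y y' \<alpha> \<beta> \<kappa> \<alpha>' \<beta>' \<kappa>'
    using that eq[OF that(1)] unfolding V_def p[symmetric]
    by (subst sum_frame_vec) (simp_all add: orth ee e_perp)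
  have V_cnj: "cnj (V x y \<alpha> \<beta> \<kappa> $ j) = V x y (cnj \<alpha>) (cnj \<beta>) (cnj \<kappa>) $ j" for x y \<alpha> \<beta> \<kappa> j
    by (simp add: V_def cnj_frame_vec)

  have in_Q: "?X (s, x) \<in> complex_sphere" if "s \<in> I" "x \<in> equator" for s x
    using sq[OF that(1)] that(2)
    by (simp add: complex_sphere_def quad_def power2_eq_square X prods)
  have tan: "dX s x v \<in> tangent_Q (?X (s, x))" if "s \<in> I" "x \<in> equator" "v \<in> tangent_prod (s, x)" for s x v
  proof (cases v)
    case (Pair a \<eta>)
    have "\<gamma> s * (of_real a * \<gamma>' s) + \<rho> s * (of_real a * \<rho>' s) = of_real a * (\<gamma> s * \<gamma>' s + \<rho> s * \<rho>' s)"
      by (simp add: algebra_simps)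
    with that tang[of \<eta> x a s] sq'[of s] show ?thesis
      by (simp add: Pair tangent_Q_iff X dX_def prods)
  qed

  have imm: "immersion_on (I \<times> equator) tangent_prod ?X"
    unfolding immersion_on_def
  proof (intro conjI ballI smooth_on_X_map assms)
    fix q assume "q \<in> I \<times> (equator :: 'n rvec set)"
    then obtain s x where q: "q = (s, x)" "s \<in> I" "x \<in> equator" by auto
    have "v = w" if vw: "v \<in> tangent_prod q" "w \<in> tangent_prod q" "dX s x v = dX s x w" for v w
    proof -
      obtain a \<eta> b \<zeta> where v: "v = (a, \<eta>)" "w = (b, \<zeta>)" by (cases v, cases w)
      note t = vw(1,2)[unfolded v q tang[symmetric]]
      \<comment> \<open>pairing with \<open>p\<close> recovers the component along \<open>I\<close>\<close>
      have "(\<Sum>j\<in>UNIV. dX s x v $ j * V x 0 1 0 0 $ j) = (\<Sum>j\<in>UNIV. dX s x w $ j * V x 0 1 0 0 $ j)"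
        by (simp only: vw)
      then have "of_real a * \<gamma>' s = of_real b * \<gamma>' s"
        using t q by (simp add: v dX_def prods)
      moreover have "\<gamma>' s \<noteq> 0" using assms(10) q by (simp add: \<gamma>'_def)
      ultimately have ab: "a = b" by simp
      have "A *v \<eta> = A *v \<zeta>"
        using vw(3) \<rho>0[OF q(2)] by (simp add: v dX_def V_def frame_vec_def ab vec_eq_iff)
      then have "(A *v (\<eta> - \<zeta>)) \<bullet> (A *v (\<eta> - \<zeta>)) = 0" by (simp add: matrix_vector_mult_diff_distrib)
      then have "\<eta> = \<zeta>" by (simp add: orth)
      with ab v show ?thesis by simp
    qed
    then have "inj_on (dX s x) (tangent_prod q)" by (intro inj_onI)
    with dX[OF q(2)] q(1) show "\<exists>D. (?X has_derivative D) (at q within I \<times> equator) \<and> inj_on D (tangent_prod q)"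
      by blast
  qed

  have lagr: "\<omega> (?X (s, x)) (dX s x v) (dX s x w) = 0"
    if s: "s \<in> I" and x: "x \<in> equator" and vw: "v \<in> tangent_prod (s, x)" "w \<in> tangent_prod (s, x)" for s x v w
  proof (rule stenzel_form_eq_0[OF assms(2) in_Q[OF s x] tan[OF s x vw(1)] tan[OF s x vw(2)]])
    obtain a \<eta> b \<zeta> where v: "v = (a, \<eta>)" "w = (b, \<zeta>)" by (cases v, cases w)
    note t = vw[unfolded v tang[symmetric]]
    have "(\<Sum>j\<in>UNIV. dX s x v $ j * cnj (dX s x w $ j)) =
      of_real (a * b) * (\<gamma>' s * cnj (\<gamma>' s) + \<rho>' s * cnj (\<rho>' s)) + of_real (\<eta> \<bullet> \<zeta>) * (\<rho> s * cnj (\<rho> s))"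
      using t x by (simp add: v dX_def V_cnj prods algebra_simps)
    then show "(\<Sum>j\<in>UNIV. dX s x v $ j * cnj (dX s x w $ j)) \<in> \<real>"
      by (simp add: complex_mult_cnj)
    have \<theta>: "(\<Sum>j\<in>UNIV. cnj (?X (s, x) $ j) * V x \<xi> (of_real c * \<gamma>' s) (of_real c * \<rho>' s) (\<rho> s) $ j) =
      of_real c * (cnj (\<gamma> s) * \<gamma>' s + cnj (\<rho> s) * \<rho>' s)" if "\<xi> $ None = 0 \<and> x \<bullet> \<xi> = 0" for c \<xi>
      using that x by (simp add: X V_cnj prods algebra_simps)
    let ?h = "cnj (\<gamma> s) * \<gamma>' s + cnj (\<rho> s) * \<rho>' s"
    have "(of_real a * ?h) * cnj (of_real b * ?h) = of_real (a * b) * (?h * cnj ?h)" by simp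
    also have "\<dots> \<in> \<real>" by (simp only: complex_mult_cnj Reals_mult Reals_of_real)
    finally show "(\<Sum>j\<in>UNIV. cnj (?X (s, x) $ j) * dX s x v $ j) *
      cnj (\<Sum>j\<in>UNIV. cnj (?X (s, x) $ j) * dX s x w $ j) \<in> \<real>"
      using t by (simp only: v dX_def prod.case \<theta>)
  qed

  have vol: "\<Omega> (?X (s, x)) (\<lambda>k. dX s x (a k, \<eta> k)) =
      of_real ((-1) ^ ?n / 2 * det (\<chi> j. case j of None \<Rightarrow> x | Some k \<Rightarrow> a k *\<^sub>R e + \<eta> k)) *
      (\<gamma>' s * \<rho> s ^ (?n - 2))"
    if s: "s \<in> I" and x: "x \<in> equator" and \<eta>: "\<And>k. (a k, \<eta> k) \<in> tangent_prod (s, x)" for s x a \<eta>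
  proof -
    have \<eta>': "\<eta> k $ None = 0" "x \<bullet> \<eta> k = 0" for k using \<eta>[of k] tang by blast+
    have "x \<noteq> 0" using eq[OF x] by auto
    have "\<Omega> (?X (s, x)) (\<lambda>k. dX s x (a k, \<eta> k)) = (-1) ^ ?n / 2 *
      dz_volume (case_option (?X (s, x)) (\<lambda>k. dX s x (a k, \<eta> k)))"
      by (intro holomorphic_volume_form_tangent assms in_Q tan s x \<eta>)
    also have "case_option (?X (s, x)) (\<lambda>k. dX s x (a k, \<eta> k)) =
      case_option (frame_vec (A *v e) (A *v x) 0 (\<gamma> s) (\<rho> s) 0)
        (\<lambda>k. frame_vec (A *v e) (A *v x) (A *v \<eta> k) (of_real (a k) * \<gamma>' s) (of_real (a k) * \<rho>' s) (\<rho> s))"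
      by (simp add: X dX_def V_def p)
    also have "dz_volume \<dots> = \<gamma>' s * \<rho> s ^ (?n - 2) *
      of_real (det (\<chi> j. case j of None \<Rightarrow> x | Some k \<Rightarrow> a k *\<^sub>R e + \<eta> k))"
      unfolding dz_volume_frame_vec[OF detA]
      by (intro det_frame assms(1) \<open>x \<noteq> 0\<close> eq x e \<eta>' sq sq' \<rho>0 s)
    finally show ?thesis by (simp add: mult_ac)
  qed

  have Im_mult: "Im (of_real r * c) = r * Im c" for r :: real and c by simp
  have "special_lagrangian \<omega> \<Omega> (I \<times> equator) tangent_prod ?X \<longleftrightarrow>
    (\<forall>s\<in>I. Im (\<gamma>' s * \<rho> s ^ (?n - 2)) = 0)"
  proof
    assume L: "special_lagrangian \<omega> \<Omega> (I \<times> equator) tangent_prod ?X"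
    show "\<forall>s\<in>I. Im (\<gamma>' s * \<rho> s ^ (?n - 2)) = 0"
    proof
      fix s assume s: "s \<in> I"
      define x :: "'n rvec" where "x = axis (Some undefined) 1"
      have x: "x \<in> equator" by (simp add: x_def equator_def norm_eq_1 inner_axis_axis) (simp add: axis_def)
      obtain a \<eta> where \<eta>: "\<forall>k. \<eta> k $ None = 0 \<and> x \<bullet> \<eta> k = 0"
        and R: "det (\<chi> j. case j of None \<Rightarrow> x | Some k \<Rightarrow> a k *\<^sub>R e + \<eta> k) \<noteq> 0"
        using exists_tangent_frame[OF ee e eq[OF x]] by blast
      have t: "(a k, \<eta> k) \<in> tangent_prod (s, x)" for k using \<eta> tang by blast
      have "(s, x) \<in> I \<times> equator" using s x by simp
      from L[unfolded special_lagrangian_def, THEN conjunct2, THEN conjunct2, THEN bspec, OF this,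
          THEN spec, THEN mp, OF dX[OF s], THEN conjunct2, THEN spec, of "\<lambda>k. (a k, \<eta> k)"]
      have "Im (\<Omega> (?X (s, x)) (\<lambda>k. dX s x (a k, \<eta> k))) = 0" using t by simp
      with R show "Im (\<gamma>' s * \<rho> s ^ (?n - 2)) = 0"
        unfolding vol[OF s x t] Im_mult by simp
    qed
  next
    assume im: "\<forall>s\<in>I. Im (\<gamma>' s * \<rho> s ^ (?n - 2)) = 0"
    show "special_lagrangian \<omega> \<Omega> (I \<times> equator) tangent_prod ?X"
      unfolding special_lagrangian_def
    proof (intro conjI ballI allI impI imm)
      show "?X ` (I \<times> equator) \<subseteq> complex_sphere" using in_Q by auto
    next
      fix q D assume q: "q \<in> I \<times> (equator :: 'n rvec set)"
        and D: "(?X has_derivative D) (at q within I \<times> equator)"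
      then obtain s x where sx: "q = (s, x)" "s \<in> I" "x \<in> equator" by auto
      have D_eq: "D v = dX s x v" if "v \<in> tangent_prod q" for v
        using tangent_prod_derivative_unique[OF D[unfolded sx] dX[OF sx(2)] sx(2) lim[OF sx(2)] sx(3)]
          that unfolding sx .
      show "\<omega> (?X q) (D v) (D w) = 0" if "v \<in> tangent_prod q" "w \<in> tangent_prod q" for v w
        using lagr[OF sx(2,3)] that by (simp add: D_eq sx(1))
      show "Im (\<Omega> (?X q) (\<lambda>i. D (v i))) = 0" if v: "\<forall>i. v i \<in> tangent_prod q" for v
      proof -
        have t: "(fst (v i), snd (v i)) \<in> tangent_prod (s, x)" for i using v sx(1) by simp
        have "Im (\<Omega> (?X (s, x)) (\<lambda>i. dX s x (fst (v i), snd (v i)))) = 0"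
          unfolding vol[OF sx(2,3) t] Im_mult using im sx(2) by simp
        then show ?thesis using D_eq v by (simp add: sx(1))
      qed
    qed
  qed
  with in_Q imm show ?thesis by (auto simp: \<gamma>'_def)
qed

end
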